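(* Consider the problem $\min\{f(x):x\in X,\ g(x)\le0\}$ with $g(x)=\max_{i\in\{1,\dots,m\}}g_i(x)$. Assume that $X$ is bounded, that for some constants $M_f,M_g$ $$|f(x)-f(y)|\le M_f\|x-y\|_E,\qquad |g(x)-g(y)|\le M_g\|x-y\|_E\qquad\text{for all }x,y\in X,$$ and that $\Theta_0>0$ is a known constant with $\max_{x\in X}d(x)\le\Theta_0^2$. Let $\varepsilon>0$. Then the modified Adaptive Mirror Descent algorithm (described in the context), run with inputs $\varepsilon$ and $\Theta_0$, stops after not more than $$k=\left\lceil\frac{2\max\{M_f^2,M_g^2\}\,\Theta_0^2}{\varepsilon^2}\right\rceil$$ iterations, and the pair $(\bar x^k,\bar\lambda^k)$ it returns satisfies $$f(\bar x^k)-\varphi(\bar\lambda^k)\le\varepsilon,\qquad g(\bar x^k)\le\varepsilon,$$ where $\varphi(\lambda)=\min_{x\in X}\big\{f(x)+\sum_{i=1}^m\lambda_ig_i(x)\big\}$, $\lambda_i\ge0$, is the dual objective.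
   Context: **Problem.** $E$ is a finite-dimensional real vector space with norm $\|\cdot\|_E$, $E^*$ its dual, $\langle p,x\rangle$ the value of $p\in E^*$ at $x\in E$, and $\|p\|_{E,*}=\max\{\langle p,x\rangle:\|x\|_E\le1\}$. $X\subset E$ is closed and convex; $f:X\to\mathbb{R}$ and $g_i:E\to\mathbb{R}$, $i=1,\dots,m$, (hence $g$) are convex. The problem is regular: there is a point $\bar x$ in the relative interior of $X$ with $g(\bar x)<0$. The dual problem is to maximize $\varphi(\lambda)$ over $\lambda_i\ge0$, $i=1,\dots,m$. $\nabla f(x)$, $\nabla g(x)$, $\nabla g_i(x)$ denote any subgradients of $f$, $g$, $g_i$ at $x$. **Proximal setup.** $d$ is a prox-function: it is continuous and convex on $X$; on the set $X^0\subseteq X$ of points where a subgradient of $d$ exists it admits a continuous selection of subgradients $\nabla d(x)$; it is 1-strongly convex: $d(y)-d(x)-\langle\nabla d(x),y-x\rangle\ge\frac12\|y-x\|_E^2$ for $x\in X^0,y\in X$; and $\min_{x\in X}d(x)=0$. For $z\in X^0$, $x\in X$ the Bregman divergence is $V[z](x)=d(x)-d(z)-\langle\nabla d(z),x-z\rangle$. For $x\in X^0$, $p\in E^*$, $\mathrm{Mirr}[x](p)=\arg\min_{u\in X}\{\langle p,u\rangle+V[x](u)\}$, assumed to be easily computable. **Algorithm (modified Adaptive Mirror Descent).** Start with $x^0=\arg\min_{x\in X}d(x)$, $I=\emptyset$, $k=0$. Repeat: - if $g(x^k)\le\varepsilon$ (productive step): $M_k=\|\nabla f(x^k)\|_{E,*}$,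 $h_k=\varepsilon/M_k^2$, $x^{k+1}=\mathrm{Mirr}[x^k](h_k\nabla f(x^k))$, and add $k$ to $I$; - otherwise (non-productive step): choose an active constraint, i.e. an index $i(k)\in\{1,\dots,m\}$ with $g(x^k)=g_{i(k)}(x^k)$, take $\nabla g(x^k)=\nabla g_{i(k)}(x^k)$, and set $M_k=\|\nabla g(x^k)\|_{E,*}$, $h_k=\varepsilon/M_k^2$, $x^{k+1}=\mathrm{Mirr}[x^k](h_k\nabla g(x^k))$; - set $k\leftarrow k+1$; until $\sum_{j=0}^{k-1}\frac1{M_j^2}\ge\frac{2\Theta_0^2}{\varepsilon^2}$. With $J=\{0,\dots,k-1\}\setminus I$, return $$\bar x^k=\frac{\sum_{i\in I}h_ix^i}{\sum_{i\in I}h_i},\qquad \bar\lambda_i^k=\frac{1}{\sum_{j\in I}h_j}\sum_{j\in J,\ i(j)=i}h_j,\quad i=1,\dots,m.$$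
   Formalization: Added assumptions: M_k is nonzero at productive steps performed (else h_k is undefined), and at iterates x^k outside the interior of X, M_k ≤ M_f (productive) or M_k ≤ M_g (non-productive); for arbitrary subgradients at such points the iteration bound is false. *)

theory Defs
  imports "HOL-Analysis.Analysis"
begin

text \<open>
  The space \<open>E\<close> is a type of class \<^class>\<open>real_normed_vector\<close>, so that its norm is arbitrary;
  finite dimension is a separate predicate. The dual space is the type of bounded linear
  functionals, whose operator norm is the dual norm (lemma \<open>norm_dual_eq\<close>).
\<close>

type_synonym 'a dual = "'a \<Rightarrow>\<^sub>L real"

definition finite_dimensional :: "'a::real_normed_vector itself \<Rightarrow> bool" where
  "finite_dimensional _ \<longleftrightarrow> (\<exists>B::'a set. finite B \<and> span B = UNIV)"

lemma norm_dual_eq: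
  fixes p :: "'a::real_normed_vector dual"
  shows "norm p = (SUP x\<in>cball 0 1. blinfun_apply p x)"
proof (rule antisym)
  let ?s = "SUP x\<in>cball 0 1. blinfun_apply p x"
  have bdd: "bdd_above (blinfun_apply p ` cball 0 1)"
  proof (rule bdd_aboveI2)
    fix x :: 'a assume "x \<in> cball 0 1"
    then show "blinfun_apply p x \<le> norm p"
      using norm_blinfun[of p x] mult_left_mono[of "norm x" 1 "norm p"] by auto
  qed
  show "?s \<le> norm p"
  proof (rule cSUP_least)
    fix x :: 'a assume "x \<in> cball 0 1"
    then show "blinfun_apply p x \<le> norm p"
      using norm_blinfun[of p x] mult_left_mono[of "norm x" 1 "norm p"] by auto
  qed auto
  have le: "blinfun_apply p x \<le> ?s" if "norm x \<le> 1" for x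
    by (rule cSUP_upper[OF _ bdd]) (use that in auto)
  show "norm p \<le> ?s"
  proof (rule norm_blinfun_bound)
    show "0 \<le> ?s" using le[of 0] by (simp add: blinfun.zero_right)
    fix x :: 'a
    have *: "blinfun_apply p y \<le> ?s * norm y" for y
    proof (cases "y = 0")
      case False
      have "blinfun_apply p (inverse (norm y) *\<^sub>R y) \<le> ?s"
        by (rule le) (use False in simp)
      with False show ?thesis by (simp add: blinfun.scaleR_right field_simps)
    qed (simp add: blinfun.zero_right)
    show "norm (blinfun_apply p x) \<le> ?s * norm x"
      using *[of x] *[of "- x"] by (simp add: blinfun.minus_right abs_le_iff)
  qed
qed

text \<open>Subgradients at \<open>x\<close> of a function whose domain is the set \<open>S\<close>.\<close>

definition subdifferential ::
  "'a::real_normed_vector set \<Rightarrow> ('a \<Rightarrow> real) \<Rightarrow> 'a \<Rightarrow> 'a dual set" where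
  "subdifferential S f x =
    {p. x \<in> S \<and> (\<forall>y\<in>S. f x + blinfun_apply p (y - x) \<le> f y)}"

definition prox_points :: "'a::real_normed_vector set \<Rightarrow> ('a \<Rightarrow> real) \<Rightarrow> 'a set" where
  "prox_points X d = {x \<in> X. subdifferential X d x \<noteq> {}}"

definition prox_function ::
  "'a::real_normed_vector set \<Rightarrow> ('a \<Rightarrow> real) \<Rightarrow> ('a \<Rightarrow> 'a dual) \<Rightarrow> bool" where
  "prox_function X d dd \<longleftrightarrow>
     continuous_on X d \<and> convex_on X d \<and>
     (\<forall>x\<in>prox_points X d. dd x \<in> subdifferential X d x) \<and>
     continuous_on (prox_points X d) dd \<and>
     (\<forall>x\<in>prox_points X d. \<forall>y\<in>X.
        1/2 * (norm (y - x))\<^sup>2 \<le> d y - d x - blinfun_apply (dd x) (y - x)) \<and>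
     (\<exists>x\<in>X. d x = 0) \<and> (\<forall>x\<in>X. 0 \<le> d x)"

definition bregman ::
  "('a::real_normed_vector \<Rightarrow> real) \<Rightarrow> ('a \<Rightarrow> 'a dual) \<Rightarrow> 'a \<Rightarrow> 'a \<Rightarrow> real" where
  "bregman d dd z x = d x - d z - blinfun_apply (dd z) (x - z)"

definition mirr ::
  "'a::real_normed_vector set \<Rightarrow> ('a \<Rightarrow> real) \<Rightarrow> ('a \<Rightarrow> 'a dual) \<Rightarrow> 'a \<Rightarrow> 'a dual \<Rightarrow> 'a" where
  "mirr X d dd x p = arg_min_on (\<lambda>u. blinfun_apply p u + bregman d dd x u) X"

definition max_constraint :: "nat \<Rightarrow> (nat \<Rightarrow> 'a \<Rightarrow> real) \<Rightarrow> 'a \<Rightarrow> real" where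
  "max_constraint m g x = Max ((\<lambda>i. g i x) ` {1..m})"

text \<open>For continuous \<open>f\<close>, \<open>g i\<close> and compact nonempty \<open>X\<close> the infimum is attained.\<close>

definition dual_objective ::
  "'a set \<Rightarrow> ('a \<Rightarrow> real) \<Rightarrow> nat \<Rightarrow> (nat \<Rightarrow> 'a \<Rightarrow> real) \<Rightarrow> (nat \<Rightarrow> real) \<Rightarrow> real" where
  "dual_objective X f m g l = (INF x\<in>X. f x + (\<Sum>i=1..m. l i * g i x))"

text \<open>
  A run is described by the sequences of iterates \<open>x k\<close>, of the subgradients \<open>p k\<close> used at
  iteration \<open>k\<close>, and of the indices \<open>ix k\<close> of the active constraints chosen at the
  non-productive iterations. So \<open>M\<^sub>k\<close> is \<open>norm (p k)\<close>.
\<close>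

definition step_size :: "real \<Rightarrow> (nat \<Rightarrow> 'a::real_normed_vector dual) \<Rightarrow> nat \<Rightarrow> real" where
  "step_size eps p k = eps / (norm (p k))\<^sup>2"

definition stop_test ::
  "real \<Rightarrow> real \<Rightarrow> (nat \<Rightarrow> 'a::real_normed_vector dual) \<Rightarrow> nat \<Rightarrow> bool" where
  "stop_test eps Theta p k \<longleftrightarrow> (\<Sum>j<k. 1 / (norm (p j))\<^sup>2) \<ge> 2 * Theta\<^sup>2 / eps\<^sup>2"

text \<open>
  Iteration \<open>k\<close> (counted from 0) is carried out iff the stopping test has not succeeded before.
  The test fails for \<open>k = 0\<close> when \<open>Theta\<close> and \<open>eps\<close> are positive, so that at least one
  iteration is carried out, as in a repeat-until loop.
\<close>

definition performed ::
  "real \<Rightarrow> real \<Rightarrow> (nat \<Rightarrow> 'a::real_normed_vector dual) \<Rightarrow> nat \<Rightarrow> bool" where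
  "performed eps Theta p k \<longleftrightarrow> (\<forall>n\<le>k. \<not> stop_test eps Theta p n)"

definition stops_after ::
  "real \<Rightarrow> real \<Rightarrow> (nat \<Rightarrow> 'a::real_normed_vector dual) \<Rightarrow> nat \<Rightarrow> bool" where
  "stops_after eps Theta p N \<longleftrightarrow>
     stop_test eps Theta p N \<and> (\<forall>n<N. \<not> stop_test eps Theta p n)"

text \<open>Nothing is required of the sequences beyond the iterations that are carried out.\<close>

definition amd_run ::
  "'a::real_normed_vector set \<Rightarrow> ('a \<Rightarrow> real) \<Rightarrow> nat \<Rightarrow> (nat \<Rightarrow> 'a \<Rightarrow> real) \<Rightarrow>
   ('a \<Rightarrow> real) \<Rightarrow> ('a \<Rightarrow> 'a dual) \<Rightarrow> real \<Rightarrow> real \<Rightarrow>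
   (nat \<Rightarrow> 'a) \<Rightarrow> (nat \<Rightarrow> 'a dual) \<Rightarrow> (nat \<Rightarrow> nat) \<Rightarrow> bool" where
  "amd_run X f m g d dd eps Theta x p ix \<longleftrightarrow>
     x 0 = arg_min_on d X \<and>
     (\<forall>k. performed eps Theta p k \<longrightarrow>
        (if max_constraint m g (x k) \<le> eps
         then p k \<in> subdifferential X f (x k)
         else ix k \<in> {1..m} \<and> g (ix k) (x k) = max_constraint m g (x k) \<and>
              p k \<in> subdifferential UNIV (g (ix k)) (x k)) \<and>
        x (Suc k) = mirr X d dd (x k) (step_size eps p k *\<^sub>R p k))"

definition productive ::
  "nat \<Rightarrow> (nat \<Rightarrow> 'a \<Rightarrow> real) \<Rightarrow> real \<Rightarrow> (nat \<Rightarrow> 'a) \<Rightarrow> nat \<Rightarrow> nat set" where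
  "productive m g eps x N = {k. k < N \<and> max_constraint m g (x k) \<le> eps}"

definition primal_output ::
  "nat \<Rightarrow> (nat \<Rightarrow> 'a::real_normed_vector \<Rightarrow> real) \<Rightarrow> real \<Rightarrow>
   (nat \<Rightarrow> 'a) \<Rightarrow> (nat \<Rightarrow> 'a dual) \<Rightarrow> nat \<Rightarrow> 'a" where
  "primal_output m g eps x p N =
     (1 / (\<Sum>k\<in>productive m g eps x N. step_size eps p k)) *\<^sub>R
     (\<Sum>k\<in>productive m g eps x N. step_size eps p k *\<^sub>R x k)"

definition dual_output ::
  "nat \<Rightarrow> (nat \<Rightarrow> 'a::real_normed_vector \<Rightarrow> real) \<Rightarrow> real \<Rightarrow>
   (nat \<Rightarrow> 'a) \<Rightarrow> (nat \<Rightarrow> 'a dual) \<Rightarrow> (nat \<Rightarrow> nat) \<Rightarrow> nat \<Rightarrow> nat \<Rightarrow> real" where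
  "dual_output m g eps x p ix N i =
     1 / (\<Sum>k\<in>productive m g eps x N. step_size eps p k) *
     (\<Sum>j | j \<in> {..<N} - productive m g eps x N \<and> ix j = i. step_size eps p j)"

end

theory Submission
  imports Defs
begin

text \<open>
  Fix a comparison point \<open>u\<close> in \<open>X\<close>. Each mirror step satisfies
  \<open>h\<^sub>k \<langle>p\<^sub>k, x\<^sub>k - u\<rangle> \<le> V[x\<^sub>k](u) - V[x\<^sub>k\<^sub>+\<^sub>1](u) + h\<^sub>k\<^sup>2 \<parallel>p\<^sub>k\<parallel>\<^sup>2 / 2\<close>, and these inequalities telescope
  (lemma \<open>mirror_descent_regret\<close>). With \<open>h\<^sub>k = \<epsilon> / M\<^sub>k\<^sup>2\<close> the quadratic terms add up to half of
  \<open>\<epsilon> \<Sum>h\<^sub>k\<close>, and the stopping test says exactly that the initial term, at most \<open>\<Theta>\<^sub>0\<^sup>2\<close>, is at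
  most the other half. So the weighted sum of the \<open>\<langle>p\<^sub>k, x\<^sub>k - u\<rangle>\<close> is at most \<open>\<epsilon> \<Sum>h\<^sub>k\<close>.

  A productive step contributes at least \<open>h\<^sub>k (f(x\<^sub>k) - f(u))\<close> to this sum, and a non-productive
  one more than \<open>h\<^sub>k (\<epsilon> - g\<^sub>i\<^sub>(\<^sub>k\<^sub>)(u))\<close>. The terms \<open>h\<^sub>k \<epsilon>\<close> of the non-productive steps cancel
  against the right-hand side. Division by the total weight of the productive steps turns the
  constraint terms into \<open>\<Sum>\<lambda>\<^sub>i g\<^sub>i(u)\<close>, Jensen's inequality replaces the average of the
  \<open>f(x\<^sub>k)\<close> by \<open>f\<close> at the primal output, and the infimum over \<open>u\<close> gives the bound on the
  duality gap. There is a productive step, because otherwise a Slater point for \<open>u\<close> would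
  make the sum exceed its bound. The bound on the number of iterations holds since
  \<open>M\<^sub>k \<le> max {M\<^sub>f, M\<^sub>g}\<close>: at interior points of \<open>X\<close> by the Lipschitz conditions, elsewhere by
  assumption on the chosen subgradients.

  The delicate point is the optimality condition of a mirror step. If \<open>z\<close> minimizes
  \<open>d + \<langle>q, \<cdot>\<rangle>\<close> over \<open>X\<close>, then \<open>- q\<close> is one subgradient of \<open>d\<close> at \<open>z\<close>, but the Bregman
  divergence uses the selected subgradient \<open>\<nabla>d(z)\<close>, which may differ from it on the boundary of
  \<open>X\<close>. What saves the argument is the continuity of the selection: in every direction that
  points from \<open>z\<close> into \<open>X\<close>, the value \<open>\<nabla>d(z)\<close> is the largest among the subgradients
  (lemma \<open>subgradient_selection_extremal\<close>). Its proof needs points with subgradients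
  near any given point of \<open>X\<close>; they are obtained as minimizers of \<open>d\<close> plus a steep
  quadratic form, which exists because the space is finite-dimensional.
\<close>

section \<open>Finite-dimensional normed spaces\<close>

lemma closed_imp_positive_distance:
  fixes S :: "'a::metric_space set"
  assumes "closed S" "b \<notin> S"
  obtains \<delta> where "\<delta> > 0" "\<forall>s\<in>S. \<delta> \<le> dist b s"
proof -
  obtain \<delta> where "\<delta> > 0" "ball b \<delta> \<subseteq> - S"
    using assms open_contains_ball[of "- S"] by (auto simp: open_Compl)
  then show ?thesis using that[of \<delta>] by (force simp: not_less)
qed

text \<open>
  Scaling by the inverse of \<open>k\<close> turns \<open>v\<close> into the difference of \<open>b\<close> and an element of the
  subspace. So coefficients are controlled by the norm as soon as \<open>b\<close> keeps a distance from it.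
\<close>

lemma coefficient_le_norm:
  fixes S :: "'a::real_normed_vector set"
  assumes "subspace S" and sep: "\<forall>s\<in>S. \<delta> \<le> dist b s" and v: "v - k *\<^sub>R b \<in> S"
  shows "\<bar>k\<bar> * \<delta> \<le> norm v"
proof (cases "k = 0")
  case False
  have "- inverse k *\<^sub>R (v - k *\<^sub>R b) \<in> S"
    using assms(1) v by (rule subspace_scale)
  from bspec[OF sep this] have "\<delta> \<le> norm (inverse k *\<^sub>R v)"
    using False by (simp add: dist_norm algebra_simps)
  then show ?thesis using False by (simp add: field_simps)
qed simp

lemma closedI_bounded_sequences:
  fixes T :: "'a::real_normed_vector set"
  assumes "\<And>v :: nat \<Rightarrow> 'a. bounded (range v) \<Longrightarrow> range v \<subseteq> T \<Longrightarrow>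
    \<exists>l\<in>T. \<exists>r. strict_mono r \<and> (v \<circ> r) \<longlonglongrightarrow> l"
  shows "closed T"
  unfolding closed_sequential_limits
proof (intro allI impI, elim conjE)
  fix w l assume w: "\<forall>n. w n \<in> T" and wl: "w \<longlonglongrightarrow> l"
  obtain l' r where "l' \<in> T" "strict_mono r" "(w \<circ> r) \<longlonglongrightarrow> l'"
    using assms[of w] convergent_imp_bounded[OF wl] w by blast
  then show "l \<in> T"
    using LIMSEQ_subseq_LIMSEQ[OF wl] LIMSEQ_unique by blast
qed

text \<open>
  Bolzano-Weierstrass holds without an inner product or coordinates, by adding one generator
  \<open>b\<close> at a time. The span of the previous generators is closed by the induction hypothesis, so
  that \<open>b\<close> has a positive distance from it; hence the coefficients of \<open>b\<close> are bounded, and so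
  are the remainders in the smaller span.
\<close>

lemma bounded_sequence_in_finite_span:
  fixes S :: "'a::real_normed_vector set" and v :: "nat \<Rightarrow> 'a"
  assumes "finite S" "bounded (range v)" "range v \<subseteq> span S"
  shows "\<exists>l\<in>span S. \<exists>r. strict_mono r \<and> (v \<circ> r) \<longlonglongrightarrow> l"
  using assms
proof (induction S arbitrary: v rule: finite_induct)
  case empty
  then have "v = (\<lambda>n. 0)" by auto
  moreover from this have "(v \<circ> id) \<longlonglongrightarrow> 0" by simp
  ultimately show ?case using strict_mono_id[where 'a = nat] by auto
next
  case (insert b S)
  show ?case
  proof (cases "b \<in> span S")
    case True
    then show ?thesis using insert by (simp add: span_redundant)
  next
    case False
    have "closed (span S)"
      by (rule closedI_bounded_sequences, rule insert.IH)
    then obtain \<delta> where \<delta>: "\<delta> > 0" "\<forall>s\<in>span S. \<delta> \<le> dist b s"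
      using closed_imp_positive_distance[OF _ False] by blast
    have "\<exists>k. v n - k *\<^sub>R b \<in> span S" for n
      using insert.prems(2) unfolding span_insert by auto
    then obtain k where k: "\<And>n. v n - k n *\<^sub>R b \<in> span S" by metis
    obtain C where C: "\<And>n. norm (v n) \<le> C"
      using insert.prems(1) by (auto simp: bounded_iff)
    have k_le: "\<bar>k n\<bar> * \<delta> \<le> C" for n
      using order.trans[OF coefficient_le_norm[OF subspace_span \<delta>(2) k] C] .
    have "bounded (range k)"
      unfolding bounded_iff using k_le \<delta>(1)
      by (intro exI[of _ "C / \<delta>"]) (auto simp: field_simps)
    then obtain r1 \<kappa> where r1: "strict_mono r1" "(k \<circ> r1) \<longlonglongrightarrow> \<kappa>"
      using bounded_imp_convergent_subsequence by blast
    let ?s = "\<lambda>n. v n - k n *\<^sub>R b"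
    have "bounded (range (?s \<circ> r1))"
      unfolding bounded_iff
    proof (intro exI ballI)
      fix y assume "y \<in> range (?s \<circ> r1)"
      then obtain n where y: "y = ?s (r1 n)" by auto
      have "norm y \<le> norm (v (r1 n)) + \<bar>k (r1 n)\<bar> * norm b"
        unfolding y by (metis norm_scaleR norm_triangle_ineq4)
      also have "\<dots> \<le> C + C / \<delta> * norm b"
        using C k_le[of "r1 n"] \<delta>(1) by (intro add_mono mult_right_mono) (auto simp: field_simps)
      finally show "norm y \<le> C + C / \<delta> * norm b" .
    qed
    moreover have "range (?s \<circ> r1) \<subseteq> span S" using k by auto
    ultimately obtain s r2 where s: "s \<in> span S" "strict_mono r2" "((?s \<circ> r1) \<circ> r2) \<longlonglongrightarrow> s"
      using insert.IH by blast
    have "(\<lambda>n. (((?s \<circ> r1) \<circ> r2) n) + ((k \<circ> r1) \<circ> r2) n *\<^sub>R b) \<longlonglongrightarrow> s + \<kappa> *\<^sub>R b"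
      by (intro tendsto_intros s(3) LIMSEQ_subseq_LIMSEQ[OF r1(2) s(2)])
    then have "(v \<circ> (r1 \<circ> r2)) \<longlonglongrightarrow> s + \<kappa> *\<^sub>R b"
      by (simp add: o_def)
    moreover have "s + \<kappa> *\<^sub>R b \<in> span (insert b S)"
      using s(1) by (auto simp: span_insert intro!: exI[of _ \<kappa>])
    ultimately show ?thesis
      using strict_mono_o[OF r1(1) s(2)] by blast
  qed
qed

lemma closed_span_finite:
  fixes S :: "'a::real_normed_vector set"
  assumes "finite S"
  shows "closed (span S)"
  by (rule closedI_bounded_sequences, rule bounded_sequence_in_finite_span[OF assms])

lemma finite_dimensional_closed_bounded_imp_compact:
  fixes X :: "'a::real_normed_vector set"
  assumes "finite_dimensional TYPE('a)" "closed X" "bounded X"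
  shows "compact X"
  unfolding compact_eq_seq_compact_metric seq_compact_def
proof (intro allI impI)
  fix v :: "nat \<Rightarrow> 'a" assume v: "\<forall>n. v n \<in> X"
  obtain S :: "'a set" where S: "finite S" "span S = UNIV"
    using assms(1) unfolding finite_dimensional_def by blast
  have "bounded (range v)"
    using assms(3) v by (metis bounded_subset image_subsetI)
  then obtain l r where "strict_mono r" "(v \<circ> r) \<longlonglongrightarrow> l"
    using bounded_sequence_in_finite_span[OF S(1)] S(2) by blast
  moreover from this have "l \<in> X"
    using closed_sequentially[OF assms(2), of "v \<circ> r" l] v by simp
  ultimately show "\<exists>l\<in>X. \<exists>r. strict_mono r \<and> (v \<circ> r) \<longlonglongrightarrow> l" by blast
qed

text \<open>
  The norm of the space need not be differentiable. This lemma provides a smooth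
  substitute, a sum of squares of functionals that dominates it; the functionals are the
  coordinates in a basis, bounded since each basis vector keeps a positive distance from the span
  of the others.
\<close>

lemma finite_dimensional_positive_definite_squares:
  assumes "finite_dimensional TYPE('a::real_normed_vector)"
  obtains B :: "'a::real_normed_vector set" and \<phi> :: "'a \<Rightarrow> 'a dual" and C :: real
  where "finite B" "C > 0" "\<And>v. (norm v)\<^sup>2 \<le> C * (\<Sum>b\<in>B. (blinfun_apply (\<phi> b) v)\<^sup>2)"
proof -
  obtain S :: "'a set" where S: "finite S" "span S = UNIV"
    using assms unfolding finite_dimensional_def by blast
  obtain B :: "'a set" where "B \<subseteq> S" "independent B" "S \<subseteq> span B"
    using maximal_independent_subset[of S] by blast
  then have B: "finite B" "independent B" "span B = UNIV"
    using S by (auto intro: finite_subset) (metis UNIV_I span_mono span_span subsetD)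
  define c where "c b v = representation B v b" for b v
  have bl: "bounded_linear (c b)" if b: "b \<in> B" for b
  proof -
    have "b \<notin> span (B - {b})"
      using B(2) b by (auto simp: dependent_def)
    then obtain \<delta> where \<delta>: "\<delta> > 0" "\<forall>s\<in>span (B - {b}). \<delta> \<le> dist b s"
      using closed_imp_positive_distance[OF closed_span_finite, of "B - {b}" b] B(1) by blast
    have "\<bar>c b v\<bar> \<le> norm v * (1 / \<delta>)" for v
    proof -
      have "v = (\<Sum>b\<in>B. c b v *\<^sub>R b)"
        unfolding c_def using sum_representation_eq[OF B(2) _ B(1), of v] B(3) by simp
      then have "v - c b v *\<^sub>R b = (\<Sum>b\<in>B-{b}. c b v *\<^sub>R b)"
        using sum.remove[OF B(1) b, of "\<lambda>b. c b v *\<^sub>R b"] by (metis add_diff_cancel_left')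
      also have "\<dots> \<in> span (B - {b})"
        by (intro span_sum span_scale span_base)
      finally have "\<bar>c b v\<bar> * \<delta> \<le> norm v"
        by (rule coefficient_le_norm[OF subspace_span \<delta>(2)])
      then show ?thesis
        using \<delta>(1) by (simp add: field_simps)
    qed
    then show ?thesis
      by (intro bounded_linear_intro[where K = "1 / \<delta>"])
        (simp_all add: c_def representation_add representation_scale B)
  qed
  define \<phi> where "\<phi> b = Blinfun (c b)" for b
  have \<phi>: "blinfun_apply (\<phi> b) v = c b v" if "b \<in> B" for b v
    unfolding \<phi>_def using bounded_linear_Blinfun_apply[OF bl[OF that]] by simp
  define C where "C = 1 + (\<Sum>b\<in>B. (norm b)\<^sup>2)"
  have "(norm v)\<^sup>2 \<le> C * (\<Sum>b\<in>B. (blinfun_apply (\<phi> b) v)\<^sup>2)" for v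
  proof -
    have "v = (\<Sum>b\<in>B. c b v *\<^sub>R b)"
      unfolding c_def using sum_representation_eq[OF B(2) _ B(1), of v] B(3) by simp
    then have "norm v \<le> (\<Sum>b\<in>B. norm b * \<bar>c b v\<bar>)"
      using norm_sum[of "\<lambda>b. c b v *\<^sub>R b" B] by (simp add: mult.commute)
    then have "(norm v)\<^sup>2 \<le> (\<Sum>b\<in>B. norm b * \<bar>c b v\<bar>)\<^sup>2"
      by (intro power_mono) auto
    also have "\<dots> \<le> (\<Sum>b\<in>B. (norm b)\<^sup>2) * (\<Sum>b\<in>B. \<bar>c b v\<bar>\<^sup>2)"
      by (rule Cauchy_Schwarz_ineq_sum)
    also have "\<dots> \<le> C * (\<Sum>b\<in>B. (c b v)\<^sup>2)"
      unfolding C_def by (simp add: sum_nonneg mult_right_mono)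
    finally show ?thesis by (simp add: \<phi>)
  qed
  moreover have "C > 0"
    unfolding C_def by (smt (verit) sum_nonneg zero_le_power2)
  ultimately show ?thesis using that B(1) by blast
qed

section \<open>Subgradients\<close>

text \<open>
  Along a segment from the minimizer \<open>z\<close>, the quadratic term changes by its derivative up to second
  order, while \<open>d\<close> lies below its chord. So minus the derivative of the quadratic term is a
  subgradient of \<open>d\<close> on all of \<open>X\<close>, even where \<open>z\<close> is a boundary point. This yields many points
  of \<^const>\<open>prox_points\<close>.
\<close>

lemma subgradient_at_regularized_minimizer:
  fixes X :: "'a::real_normed_vector set" and \<phi> :: "'b \<Rightarrow> 'a dual"
  assumes X: "convex X" and d: "convex_on X d" and z: "z \<in> X"
    and min: "\<And>y. y \<in> X \<Longrightarrow> d z + K * (\<Sum>b\<in>B. (\<phi> b (z - a))\<^sup>2)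
      \<le> d y + K * (\<Sum>b\<in>B. (\<phi> b (y - a))\<^sup>2)"
  shows "- (2 * K) *\<^sub>R (\<Sum>b\<in>B. \<phi> b (z - a) *\<^sub>R \<phi> b) \<in> subdifferential X d z"
proof -
  have "d z \<le> d y + 2 * K * (\<Sum>b\<in>B. \<phi> b (z - a) * \<phi> b (y - z))" if y: "y \<in> X" for y
  proof -
    let ?A = "\<Sum>b\<in>B. \<phi> b (z - a) * \<phi> b (y - z)" and ?D = "\<Sum>b\<in>B. (\<phi> b (y - z))\<^sup>2"
    have step: "0 \<le> (d y - d z + 2 * K * ?A) + s * (K * ?D)" if s: "0 < s" "s \<le> 1" for s
    proof -
      let ?w = "(1 - s) *\<^sub>R z + s *\<^sub>R y"
      have wX: "?w \<in> X" using X z y s by (simp add: convex_def)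
      have dw: "d ?w \<le> (1 - s) * d z + s * d y"
        using convex_onD[OF d, of s z y] z y s by simp
      have w: "?w - a = (z - a) + s *\<^sub>R (y - z)" by (simp add: algebra_simps)
      have "(\<phi> b (?w - a))\<^sup>2 = (\<phi> b (z - a))\<^sup>2 + 2 * s * (\<phi> b (z - a) * \<phi> b (y - z))
          + s\<^sup>2 * (\<phi> b (y - z))\<^sup>2" for b
        unfolding w by (simp only: blinfun.add_right blinfun.scaleR_right)
          (simp add: power2_eq_square algebra_simps)
      then have "(\<Sum>b\<in>B. (\<phi> b (?w - a))\<^sup>2)
          = (\<Sum>b\<in>B. (\<phi> b (z - a))\<^sup>2) + 2 * s * ?A + s\<^sup>2 * ?D"
        by (simp only: sum.distrib sum_distrib_left)
      with min[OF wX] dw have "0 \<le> s * ((d y - d z + 2 * K * ?A) + s * (K * ?D))"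
        by (simp add: algebra_simps power2_eq_square)
      then show ?thesis using s by (simp add: zero_le_mult_iff)
    qed
    have "((\<lambda>s. (d y - d z + 2 * K * ?A) + s * (K * ?D)) \<longlongrightarrow>
        (d y - d z + 2 * K * ?A) + 0 * (K * ?D)) (at_right 0)"
      by (intro tendsto_intros)
    moreover have "eventually (\<lambda>s::real. 0 \<le> (d y - d z + 2 * K * ?A) + s * (K * ?D)) (at_right 0)"
      using step by (auto simp: eventually_at_right_field intro!: exI[of _ 1])
    ultimately have "0 \<le> (d y - d z + 2 * K * ?A) + 0 * (K * ?D)"
      by (intro tendsto_lowerbound) auto
    then show ?thesis by simp
  qed
  then show ?thesis
    using z unfolding subdifferential_def
    by (simp add: blinfun.scaleR_left blinfun.minus_left blinfun.sum_left algebra_simps)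
qed

text \<open>
  On the boundary of \<open>X\<close>, subgradients are not unique: adding a normal vector gives another one.
  Convexity alone does not relate \<open>q\<close> to \<open>dd z\<close>, but at points \<open>w\<close> near \<open>z\<close> monotonicity of
  subgradients gives \<open>\<langle>dd w - q, w - z\<rangle> \<ge> 0\<close>. If \<open>w\<close> approaches \<open>z\<close> in the limiting
  direction \<open>u - z\<close>, the claim follows from the continuity of \<open>dd\<close>.

  The points of the segment from \<open>z\<close> to \<open>u\<close> need not admit subgradients, so \<open>w\<close> minimizes \<open>d\<close> plus
  a steep quadratic penalty for leaving the point \<open>a = z + t (u - z)\<close>. With penalty factor
  \<open>t\<^sup>-\<^sup>4\<close> the distance from \<open>w\<close> to \<open>a\<close> is of order \<open>t\<^sup>2\<close>, negligible against \<open>t\<close>, so that the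
  direction of \<open>w - z\<close> does converge to that of \<open>u - z\<close>.
\<close>

lemma subgradient_selection_extremal:
  fixes X :: "'a::real_normed_vector set"
  assumes fin: "finite_dimensional TYPE('a)" and X: "compact X" "convex X"
    and prox: "prox_function X d dd"
    and q: "q \<in> subdifferential X d z" and u: "u \<in> X"
  shows "blinfun_apply q (u - z) \<le> blinfun_apply (dd z) (u - z)"
proof -
  have z: "z \<in> X" using q by (simp add: subdifferential_def)
  have zP: "z \<in> prox_points X d" using q z by (auto simp: prox_points_def)
  have d_cont: "continuous_on X d" and d_conv: "convex_on X d"
    and dd: "\<And>x. x \<in> prox_points X d \<Longrightarrow> dd x \<in> subdifferential X d x"
    and dd_cont: "continuous_on (prox_points X d) dd"
    and d_nonneg: "\<And>x. x \<in> X \<Longrightarrow> 0 \<le> d x"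
    using prox unfolding prox_function_def by auto
  obtain D where D: "\<And>y. y \<in> X \<Longrightarrow> d y \<le> D"
    using continuous_attains_sup[OF X(1) _ d_cont] z by blast
  have "D \<ge> 0" using D[OF z] d_nonneg[OF z] by simp
  obtain B :: "'a set" and \<phi> :: "'a \<Rightarrow> 'a dual" and C :: real
    where B: "finite B" "C > 0" "\<And>v. (norm v)\<^sup>2 \<le> C * (\<Sum>b\<in>B. (blinfun_apply (\<phi> b) v)\<^sup>2)"
    by (rule finite_dimensional_positive_definite_squares[OF fin]) blast
  define t where "t n = inverse (real (Suc n))" for n
  define a where "a n = z + t n *\<^sub>R (u - z)" for n
  have t: "0 < t n" "t n \<le> 1" for n by (auto simp: t_def field_simps)
  have t0: "t \<longlonglongrightarrow> 0" unfolding t_def by (rule LIMSEQ_inverse_real_of_nat)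
  have aX: "a n \<in> X" for n
  proof -
    have "a n = (1 - t n) *\<^sub>R z + t n *\<^sub>R u" by (simp add: a_def algebra_simps)
    then show ?thesis using X(2) z u t[of n] by (simp add: convex_def)
  qed
  define F where "F n y = d y + inverse (t n ^ 4) * (\<Sum>b\<in>B. (\<phi> b (y - a n))\<^sup>2)" for n y
  have "\<exists>w\<in>X. \<forall>y\<in>X. F n w \<le> F n y" for n
    unfolding F_def using z by (intro continuous_attains_inf X(1) continuous_intros d_cont) auto
  then obtain w where w: "\<And>n. w n \<in> X" "\<And>n y. y \<in> X \<Longrightarrow> F n (w n) \<le> F n y"
    by metis
  have wP: "w n \<in> prox_points X d" for n
    using subgradient_at_regularized_minimizer[OF X(2) d_conv w(1), where a = "a n" and B = B and \<phi> = \<phi>]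
      w unfolding prox_points_def F_def by blast
  have close: "norm (w n - a n) \<le> sqrt (C * D) * (t n)\<^sup>2" for n
  proof (rule power2_le_imp_le)
    let ?Q = "\<Sum>b\<in>B. (\<phi> b (w n - a n))\<^sup>2"
    have "d (w n) + inverse (t n ^ 4) * ?Q \<le> d (a n)"
      using w(2)[OF aX, of n n] by (simp add: F_def blinfun.zero_right)
    then have "inverse (t n ^ 4) * ?Q \<le> D"
      using D[OF aX[of n]] d_nonneg[OF w(1)[of n]] by simp
    then have "?Q \<le> D * t n ^ 4" using t(1)[of n] by (simp add: field_simps)
    then have "C * ?Q \<le> C * (D * t n ^ 4)" using B(2) by simp
    with B(3)[of "w n - a n"] have "(norm (w n - a n))\<^sup>2 \<le> C * D * t n ^ 4" by simp
    also have "\<dots> = (sqrt (C * D) * (t n)\<^sup>2)\<^sup>2"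
      using B(2) \<open>D \<ge> 0\<close> by (simp add: power_mult_distrib)
    finally show "(norm (w n - a n))\<^sup>2 \<le> (sqrt (C * D) * (t n)\<^sup>2)\<^sup>2" .
    show "0 \<le> sqrt (C * D) * (t n)\<^sup>2" using B(2) \<open>D \<ge> 0\<close> by simp
  qed
  \<comment> \<open>the error of the direction \<open>(w n - z) / t n\<close> against \<open>u - z\<close>\<close>
  define e where "e n = inverse (t n) *\<^sub>R (w n - a n)" for n
  have "e \<longlonglongrightarrow> 0"
  proof (rule Lim_null_comparison)
    show "\<forall>\<^sub>F n in sequentially. norm (e n) \<le> sqrt (C * D) * t n"
    proof (rule always_eventually, rule allI)
      fix n
      have "norm (e n) = inverse (t n) * norm (w n - a n)"
        using t(1)[of n] by (simp add: e_def)
      also have "\<dots> \<le> inverse (t n) * (sqrt (C * D) * (t n)\<^sup>2)"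
        using close[of n] t(1)[of n] by (intro mult_left_mono) auto
      finally show "norm (e n) \<le> sqrt (C * D) * t n"
        using t(1)[of n] by (simp add: power2_eq_square field_simps)
    qed
    show "(\<lambda>n. sqrt (C * D) * t n) \<longlonglongrightarrow> 0"
      using tendsto_mult_left[OF t0] by simp
  qed
  have w_eq: "w n - z = t n *\<^sub>R ((u - z) + e n)" for n
    using t(1)[of n] by (simp add: e_def a_def algebra_simps)
  have "(\<lambda>n. z + t n *\<^sub>R ((u - z) + e n)) \<longlonglongrightarrow> z + 0 *\<^sub>R ((u - z) + 0)"
    by (intro tendsto_intros t0 \<open>e \<longlonglongrightarrow> 0\<close>)
  then have wz: "w \<longlonglongrightarrow> z" by (simp flip: w_eq)
  have ddw: "(\<lambda>n. dd (w n)) \<longlonglongrightarrow> dd z"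
    by (rule continuous_on_tendsto_compose[OF dd_cont wz zP]) (simp add: wP)
  have "0 \<le> blinfun_apply (dd (w n) - q) ((u - z) + e n)" for n
  proof -
    have "d z + blinfun_apply q (w n - z) \<le> d (w n)"
      using q w(1) by (simp add: subdifferential_def)
    moreover have "d (w n) + blinfun_apply (dd (w n)) (z - w n) \<le> d z"
      using dd[OF wP] z by (simp add: subdifferential_def)
    ultimately have "0 \<le> blinfun_apply (dd (w n) - q) (w n - z)"
      by (simp add: blinfun.diff_left blinfun.diff_right)
    then have "0 \<le> t n * blinfun_apply (dd (w n) - q) ((u - z) + e n)"
      by (simp only: w_eq blinfun.scaleR_right real_scaleR_def)
    then show ?thesis using t(1)[of n] by (simp add: zero_le_mult_iff)
  qed
  moreover have "(\<lambda>n. blinfun_apply (dd (w n) - q) ((u - z) + e n))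
      \<longlonglongrightarrow> blinfun_apply (dd z - q) ((u - z) + 0)"
    by (intro tendsto_intros ddw \<open>e \<longlonglongrightarrow> 0\<close>)
  ultimately have "0 \<le> blinfun_apply (dd z - q) ((u - z) + 0)"
    by (intro tendsto_lowerbound[where F = sequentially]) auto
  then show ?thesis by (simp add: blinfun.diff_left)
qed

text \<open>
  In the interior every direction is available, so that a Lipschitz bound on the linear part
  in the directions into \<open>X\<close> is a bound on the dual norm. A nonzero \<open>p\<close> rules out negative
  \<open>L\<close>, which the hypothesis alone permits in the zero space.
\<close>

lemma norm_subgradient_le:
  fixes p :: "'a::real_normed_vector dual"
  assumes x: "x \<in> interior X"
    and lip: "\<And>y. y \<in> X \<Longrightarrow> blinfun_apply p (y - x) \<le> L * norm (y - x)"
    and nz: "p \<noteq> 0"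
  shows "norm p \<le> L"
proof -
  obtain r where r: "r > 0" "cball x r \<subseteq> X"
    using x mem_interior_cball by blast
  have le: "blinfun_apply p v \<le> L * norm v" for v
  proof (cases "v = 0")
    case False
    let ?s = "r / norm v"
    have "?s > 0" using False r by simp
    have "x + ?s *\<^sub>R v \<in> X"
      using r False by (intro subsetD[OF r(2)]) (simp add: dist_norm)
    from lip[OF this] have "?s * blinfun_apply p v \<le> ?s * (L * norm v)"
      using r(1) False by (simp add: blinfun.scaleR_right mult.commute)
    then show ?thesis using \<open>?s > 0\<close> by (meson mult_le_cancel_left_pos)
  qed (simp add: blinfun.zero_right)
  have abs: "norm (blinfun_apply p v) \<le> L * norm v" for v
    using le[of v] le[of "- v"] by (simp add: blinfun.minus_right abs_le_iff)
  obtain v where "blinfun_apply p v \<noteq> 0"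
    using nz by (metis blinfun_eqI zero_blinfun.rep_eq)
  then have "0 < L * norm v"
    using abs[of v] by (smt (verit) norm_eq_zero norm_ge_zero real_norm_def)
  then have "0 \<le> L"
    by (simp add: zero_less_mult_iff)
  then show ?thesis using abs by (rule norm_blinfun_bound)
qed

section \<open>Mirror descent steps\<close>

lemma arg_min_on_minimizes:
  fixes F :: "'a \<Rightarrow> real"
  assumes "z \<in> X" "\<And>y. y \<in> X \<Longrightarrow> F z \<le> F y"
  shows "arg_min_on F X \<in> X" "y \<in> X \<Longrightarrow> F (arg_min_on F X) \<le> F y"
proof -
  have "is_arg_min F (\<lambda>x. x \<in> X) (arg_min_on F X)"
    unfolding arg_min_on_def arg_min_def
    by (rule someI[of _ z]) (use assms in \<open>auto simp: is_arg_min_linorder\<close>)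
  then show "arg_min_on F X \<in> X" "y \<in> X \<Longrightarrow> F (arg_min_on F X) \<le> F y"
    by (auto simp: is_arg_min_linorder)
qed

text \<open>
  The zero functional is a subgradient at the minimizer of \<open>d\<close>, so the selected one is nonnegative
  in all directions into \<open>X\<close> and only lowers the divergence.
\<close>

lemma prox_center:
  fixes X :: "'a::real_normed_vector set"
  assumes fin: "finite_dimensional TYPE('a)" and X: "compact X" "convex X"
    and prox: "prox_function X d dd" and u: "u \<in> X"
  shows "arg_min_on d X \<in> prox_points X d" "bregman d dd (arg_min_on d X) u \<le> d u"
proof -
  let ?z = "arg_min_on d X"
  obtain z0 where z0: "z0 \<in> X" "d z0 = 0" and nn: "\<And>y. y \<in> X \<Longrightarrow> 0 \<le> d y"
    using prox unfolding prox_function_def by blast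
  have z: "?z \<in> X" "\<And>y. y \<in> X \<Longrightarrow> d ?z \<le> d y"
    using arg_min_on_minimizes[of z0 X d] z0 nn by auto
  then have 0: "0 \<in> subdifferential X d ?z"
    by (simp add: subdifferential_def)
  then show "?z \<in> prox_points X d"
    using z(1) by (auto simp: prox_points_def)
  show "bregman d dd ?z u \<le> d u"
    using subgradient_selection_extremal[OF fin X prox 0 u] nn[OF z(1)] by (simp add: bregman_def)
qed

text \<open>
  Optimality of \<open>z'\<close>, in terms of the selected subgradient, is the three-point
  inequality \<open>\<langle>p, z' - u\<rangle> \<le> V[z](u) - V[z'](u) - V[z](z')\<close>. The cost of replacing \<open>z'\<close> by \<open>z\<close> on
  the left is \<open>\<langle>p, z - z'\<rangle>\<close>, which Young's inequality splits into \<open>\<parallel>p\<parallel>\<^sup>2 / 2\<close> and a square that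
  strong convexity absorbs in \<open>V[z](z')\<close>.
\<close>

lemma mirror_step:
  fixes X :: "'a::real_normed_vector set" and p :: "'a dual"
  assumes fin: "finite_dimensional TYPE('a)" and X: "compact X" "convex X"
    and prox: "prox_function X d dd" and z: "z \<in> prox_points X d" and u: "u \<in> X"
  defines "z' \<equiv> mirr X d dd z p"
  shows "z' \<in> prox_points X d"
    and "blinfun_apply p (z - u) \<le> bregman d dd z u - bregman d dd z' u + (norm p)\<^sup>2 / 2"
proof -
  have d_cont: "continuous_on X d" and zX: "z \<in> X"
    and strong: "\<And>y. y \<in> X \<Longrightarrow> 1/2 * (norm (y - z))\<^sup>2 \<le> bregman d dd z y"
    using prox z unfolding prox_function_def bregman_def by (auto simp: prox_points_def)
  let ?F = "\<lambda>u. blinfun_apply p u + bregman d dd z u"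
  have "\<exists>w\<in>X. \<forall>y\<in>X. ?F w \<le> ?F y"
    unfolding bregman_def using zX
    by (intro continuous_attains_inf X(1) continuous_intros d_cont) auto
  then obtain w where w: "w \<in> X" "\<And>y. y \<in> X \<Longrightarrow> ?F w \<le> ?F y" by blast
  have z': "z' \<in> X" "\<And>y. y \<in> X \<Longrightarrow> ?F z' \<le> ?F y"
    unfolding z'_def mirr_def using arg_min_on_minimizes[where F = ?F, OF w] by auto
  then have sub: "dd z - p \<in> subdifferential X d z'"
    by (fastforce simp: subdifferential_def bregman_def blinfun.diff_left blinfun.diff_right)
  then show "z' \<in> prox_points X d"
    using z'(1) by (auto simp: prox_points_def)
  have "blinfun_apply (dd z - p) (u - z') \<le> blinfun_apply (dd z') (u - z')"
    by (rule subgradient_selection_extremal[OF fin X prox sub u])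
  then have "blinfun_apply p (z' - u) \<le> bregman d dd z u - bregman d dd z' u - bregman d dd z z'"
    by (simp add: bregman_def blinfun.diff_left blinfun.diff_right)
  moreover have "blinfun_apply p (z - z') \<le> norm p * norm (z' - z)"
    using norm_blinfun[of p "z - z'"] by (simp add: norm_minus_commute)
  moreover have "norm p * norm (z' - z) \<le> (norm p)\<^sup>2 / 2 + 1/2 * (norm (z' - z))\<^sup>2"
    using zero_le_power2[of "norm p - norm (z' - z)"]
    by (simp add: power2_eq_square algebra_simps)
  ultimately show "blinfun_apply p (z - u)
      \<le> bregman d dd z u - bregman d dd z' u + (norm p)\<^sup>2 / 2"
    using strong[OF z'(1)] by (simp add: blinfun.diff_right)
qed

text \<open>
  The divergences telescope: the first is at most \<open>d u\<close> by the choice of the starting point, and the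
  last is nonnegative since \<open>dd (x N)\<close> is a subgradient.
\<close>

lemma mirror_descent_regret:
  fixes X :: "'a::real_normed_vector set" and x :: "nat \<Rightarrow> 'a"
  assumes fin: "finite_dimensional TYPE('a)" and X: "compact X" "convex X"
    and prox: "prox_function X d dd" and u: "u \<in> X"
    and x0: "x 0 = arg_min_on d X"
    and step: "\<And>k. k < N \<Longrightarrow> x (Suc k) = mirr X d dd (x k) (h k *\<^sub>R p k)"
  shows "(\<Sum>k<N. h k * blinfun_apply (p k) (x k - u)) \<le> d u + (\<Sum>k<N. (h k * norm (p k))\<^sup>2) / 2"
proof -
  have "x n \<in> prox_points X d \<and> (\<Sum>k<n. h k * blinfun_apply (p k) (x k - u))
      \<le> d u - bregman d dd (x n) u + (\<Sum>k<n. (h k * norm (p k))\<^sup>2) / 2" if "n \<le> N" for n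
    using that
  proof (induction n)
    case 0
    show ?case using prox_center[OF fin X prox u] by (simp add: x0)
  next
    case (Suc n)
    then have IH: "x n \<in> prox_points X d" "(\<Sum>k<n. h k * blinfun_apply (p k) (x k - u))
        \<le> d u - bregman d dd (x n) u + (\<Sum>k<n. (h k * norm (p k))\<^sup>2) / 2" by auto
    note ms = mirror_step[OF fin X prox IH(1) u, of "h n *\<^sub>R p n", folded step[OF Suc_le_lessD[OF Suc.prems]]]
    show ?case
      using ms IH(2) by (simp add: blinfun.scaleR_left power_mult_distrib add_divide_distrib)
  qed
  from this[of N] have xN: "x N \<in> prox_points X d" and le: "(\<Sum>k<N. h k * blinfun_apply (p k) (x k - u))
      \<le> d u - bregman d dd (x N) u + (\<Sum>k<N. (h k * norm (p k))\<^sup>2) / 2" by auto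
  have "dd (x N) \<in> subdifferential X d (x N)"
    using prox xN unfolding prox_function_def by blast
  then have "0 \<le> bregman d dd (x N) u"
    using u by (auto simp: subdifferential_def bregman_def algebra_simps)
  with le show ?thesis by simp
qed

section \<open>Constraints, stopping and averaging\<close>

lemma max_constraint_ge: "i \<in> {1..m} \<Longrightarrow> g i y \<le> max_constraint m g y"
  unfolding max_constraint_def by (intro Max_ge) auto

lemma max_constraint_le_iff:
  "m \<ge> 1 \<Longrightarrow> max_constraint m g y \<le> c \<longleftrightarrow> (\<forall>i\<in>{1..m}. g i y \<le> c)"
  unfolding max_constraint_def by (subst Max_le_iff) auto

text \<open>
  Each iteration adds at least \<open>1 / R\<close> to the sum in the stopping test. Both hypotheses on
  \<open>p k\<close> matter here: a zero subgradient would add nothing, as \<open>1 / 0 = 0\<close>.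
\<close>

lemma stops_after_bound:
  assumes R: "R > 0"
    and bound: "\<And>k. performed eps Theta p k \<Longrightarrow> p k \<noteq> 0 \<and> (norm (p k))\<^sup>2 \<le> R"
  shows "\<exists>N. stops_after eps Theta p N \<and> int N \<le> \<lceil>2 * R * Theta\<^sup>2 / eps\<^sup>2\<rceil>"
proof -
  define T where "T = nat \<lceil>2 * R * Theta\<^sup>2 / eps\<^sup>2\<rceil>"
  have T_int: "int T = \<lceil>2 * R * Theta\<^sup>2 / eps\<^sup>2\<rceil>"
    unfolding T_def using R
    by (intro nat_0_le) (simp add: order.strict_trans2[of "- 1" 0])
  have "\<exists>n\<le>T. stop_test eps Theta p n"
  proof (rule ccontr)
    assume *: "\<not> ?thesis"
    then have k: "performed eps Theta p k" if "k < T" for k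
      using that by (auto simp: performed_def)
    have "2 * R * Theta\<^sup>2 / eps\<^sup>2 \<le> real T"
      unfolding T_def by linarith
    then have "2 * Theta\<^sup>2 / eps\<^sup>2 \<le> (\<Sum>j<T. 1 / R)"
      using R by (simp add: field_simps)
    also have "\<dots> \<le> (\<Sum>j<T. 1 / (norm (p j))\<^sup>2)"
      using bound[OF k] by (intro sum_mono frac_le) auto
    finally have "stop_test eps Theta p T" by (simp add: stop_test_def)
    with * show False by auto
  qed
  then obtain n where n: "n \<le> T" "stop_test eps Theta p n" by blast
  let ?N = "LEAST n. stop_test eps Theta p n"
  have "stops_after eps Theta p ?N"
    unfolding stops_after_def using n(2) by (auto intro: LeastI dest: not_less_Least)
  moreover have "?N \<le> T" using Least_le[of "stop_test eps Theta p", OF n(2)] n(1) by simp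
  ultimately show ?thesis using T_int by (intro exI[of _ ?N]) auto
qed


lemma weighted_average:
  fixes x :: "nat \<Rightarrow> 'a::real_normed_vector"
  assumes "finite I" "\<And>k. k \<in> I \<Longrightarrow> 0 \<le> h k" "(\<Sum>k\<in>I. h k) > 0"
  defines "y \<equiv> (1 / (\<Sum>k\<in>I. h k)) *\<^sub>R (\<Sum>k\<in>I. h k *\<^sub>R x k)"
  shows "convex C \<Longrightarrow> (\<And>k. k \<in> I \<Longrightarrow> x k \<in> C) \<Longrightarrow> y \<in> C"
    and "convex_on C \<psi> \<Longrightarrow> (\<And>k. k \<in> I \<Longrightarrow> x k \<in> C) \<Longrightarrow>
      \<psi> y \<le> 1 / (\<Sum>k\<in>I. h k) * (\<Sum>k\<in>I. h k * \<psi> (x k))"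
proof -
  let ?H = "\<Sum>k\<in>I. h k"
  have y: "y = (\<Sum>k\<in>I. (h k / ?H) *\<^sub>R x k)"
    by (simp add: y_def scaleR_sum_right)
  have w: "(\<Sum>k\<in>I. h k / ?H) = 1" "\<And>k. k \<in> I \<Longrightarrow> 0 \<le> h k / ?H"
    using assms(2,3) by (auto simp flip: sum_divide_distrib)
  show "convex C \<Longrightarrow> (\<And>k. k \<in> I \<Longrightarrow> x k \<in> C) \<Longrightarrow> y \<in> C"
    unfolding y by (rule convex_sum[OF assms(1) _ w])
  assume \<psi>: "convex_on C \<psi>" and x: "\<And>k. k \<in> I \<Longrightarrow> x k \<in> C"
  have "I \<noteq> {}" using assms(3) by auto
  have "\<psi> y \<le> (\<Sum>k\<in>I. h k / ?H * \<psi> (x k))"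
    unfolding y by (rule convex_on_sum[OF assms(1) \<open>I \<noteq> {}\<close> \<psi> w x])
  then show "\<psi> y \<le> 1 / ?H * (\<Sum>k\<in>I. h k * \<psi> (x k))"
    by (simp add: sum_distrib_left)
qed

section \<open>The primal-dual guarantee\<close>

theorem theorem2:
  fixes X :: "'a::real_normed_vector set"
    and f d :: "'a \<Rightarrow> real"
    and g :: "nat \<Rightarrow> 'a \<Rightarrow> real"
    and dd :: "'a \<Rightarrow> 'a dual"
    and m :: nat
    and Mf Mg Theta0 eps :: real
    and x :: "nat \<Rightarrow> 'a"
    and p :: "nat \<Rightarrow> 'a dual"
    and ix :: "nat \<Rightarrow> nat"
  assumes fin_dim: "finite_dimensional TYPE('a)"
    and X: "closed X" "convex X" "bounded X"
    and m: "m \<ge> 1"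
    and f_convex: "convex_on X f"
    and g_convex: "\<And>i. i \<in> {1..m} \<Longrightarrow> convex_on UNIV (g i)"
    and regular: "\<exists>xb\<in>rel_interior X. max_constraint m g xb < 0"
    and prox: "prox_function X d dd"
    and f_lipschitz: "\<And>y z. y \<in> X \<Longrightarrow> z \<in> X \<Longrightarrow> \<bar>f y - f z\<bar> \<le> Mf * norm (y - z)"
    and g_lipschitz: "\<And>y z. y \<in> X \<Longrightarrow> z \<in> X \<Longrightarrow>
          \<bar>max_constraint m g y - max_constraint m g z\<bar> \<le> Mg * norm (y - z)"
    and Theta0: "Theta0 > 0" "\<And>y. y \<in> X \<Longrightarrow> d y \<le> Theta0\<^sup>2"
    and eps: "eps > 0"
    and run: "amd_run X f m g d dd eps Theta0 x p ix"
    \<comment> \<open>the step size is defined; at non-productive iterations this follows from regularity\<close>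
    and step_defined: "\<And>k. performed eps Theta0 p k \<Longrightarrow>
          max_constraint m g (x k) \<le> eps \<Longrightarrow> p k \<noteq> 0"
    \<comment> \<open>in the interior of X the Lipschitz conditions bound all subgradients,
        but outside of it some subgradients can be arbitrarily large\<close>
    and subgradient_bound: "\<And>k. performed eps Theta0 p k \<Longrightarrow> x k \<notin> interior X \<Longrightarrow>
          norm (p k) \<le> (if max_constraint m g (x k) \<le> eps then Mf else Mg)"
  shows "\<exists>N. stops_after eps Theta0 p N \<and>
           int N \<le> \<lceil>2 * max (Mf\<^sup>2) (Mg\<^sup>2) * Theta0\<^sup>2 / eps\<^sup>2\<rceil> \<and>
           primal_output m g eps x p N \<in> X \<and>
           (\<forall>i\<in>{1..m}. dual_output m g eps x p ix N i \<ge> 0) \<and>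
           f (primal_output m g eps x p N)
             - dual_objective X f m g (dual_output m g eps x p ix N) \<le> eps \<and>
           max_constraint m g (primal_output m g eps x p N) \<le> eps"
proof -
  let ?G = "max_constraint m g"
  define h where "h = step_size eps p"
  obtain xb where xb: "xb \<in> X" "?G xb < 0"
    using regular by (auto simp: rel_interior_def)
  have slater: "g i xb < 0" if "i \<in> {1..m}" for i
    using max_constraint_ge[OF that, of g xb] xb(2) by simp
  have X_compact: "compact X"
    by (rule finite_dimensional_closed_bounded_imp_compact[OF fin_dim X(1,3)])
  have run_prod: "p k \<in> subdifferential X f (x k)"
    if "performed eps Theta0 p k" "?G (x k) \<le> eps" for k
    using run that unfolding amd_run_def by auto
  have run_nonprod: "ix k \<in> {1..m}" "g (ix k) (x k) = ?G (x k)"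
      "p k \<in> subdifferential UNIV (g (ix k)) (x k)"
    if "performed eps Theta0 p k" "\<not> ?G (x k) \<le> eps" for k
    using run that unfolding amd_run_def by auto
  \<comment> \<open>a zero subgradient of a violated constraint would make it positive everywhere\<close>
  have p_nz: "p k \<noteq> 0" if k: "performed eps Theta0 p k" for k
  proof (cases "?G (x k) \<le> eps")
    case False
    note np = run_nonprod[OF k False]
    have "g (ix k) (x k) + p k (xb - x k) \<le> g (ix k) xb"
      using np(3) by (simp add: subdifferential_def)
    then show ?thesis using slater[OF np(1)] np(2) False eps by auto
  qed (use step_defined k in blast)

  define R where "R = max (Mf\<^sup>2) (Mg\<^sup>2)"
  have p_le: "(norm (p k))\<^sup>2 \<le> R" if k: "performed eps Theta0 p k" for k
  proof -
    have "norm (p k) \<le> (if ?G (x k) \<le> eps then Mf else Mg)"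
    proof (cases "x k \<in> interior X")
      case True
      then have xX: "x k \<in> X" using interior_subset by blast
      have "p k (y - x k) \<le> (if ?G (x k) \<le> eps then Mf else Mg) * norm (y - x k)"
        if y: "y \<in> X" for y
      proof (cases "?G (x k) \<le> eps")
        case prod: True
        have "f (x k) + p k (y - x k) \<le> f y"
          using run_prod[OF k prod] y by (simp add: subdifferential_def)
        then show ?thesis using f_lipschitz[OF y xX] prod by simp
      next
        case False
        note np = run_nonprod[OF k False]
        have "g (ix k) (x k) + p k (y - x k) \<le> g (ix k) y"
          using np(3) by (simp add: subdifferential_def)
        then show ?thesis
          using max_constraint_ge[OF np(1), of g y] np(2) g_lipschitz[OF y xX] False by simp
      qed
      then show ?thesis by (rule norm_subgradient_le[OF True _ p_nz[OF k]])
    qed (rule subgradient_bound[OF k])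
    then have "(norm (p k))\<^sup>2 \<le> (if ?G (x k) \<le> eps then Mf else Mg)\<^sup>2"
      by (intro power_mono) auto
    then show ?thesis by (auto simp: R_def split: if_splits)
  qed
  have not_stop0: "\<not> stop_test eps Theta0 p 0"
    using eps Theta0(1) by (simp add: stop_test_def not_le)
  then have "performed eps Theta0 p 0" by (simp add: performed_def)
  then have "R > 0" using p_nz p_le by (metis less_le_trans zero_less_norm_iff zero_less_power)
  then obtain N where N: "stops_after eps Theta0 p N"
      "int N \<le> \<lceil>2 * R * Theta0\<^sup>2 / eps\<^sup>2\<rceil>"
    using stops_after_bound[of R eps Theta0 p] p_nz p_le by blast
  have performed: "performed eps Theta0 p k" if "k < N" for k
    using N(1) that by (auto simp: stops_after_def performed_def)
  have "N > 0" using N(1) not_stop0 by (auto simp: stops_after_def intro: gr0I)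

  have h_pos: "h k > 0" if "k < N" for k
    using eps p_nz[OF performed[OF that]] by (simp add: h_def step_size_def)
  define I where "I = productive m g eps x N"
  define J where "J = {..<N} - I"
  have I: "k < N" "?G (x k) \<le> eps" if "k \<in> I" for k
    using that by (auto simp: I_def productive_def)
  have J: "k < N" "\<not> ?G (x k) \<le> eps" if "k \<in> J" for k
    using that by (auto simp: I_def J_def productive_def)
  have "I \<subseteq> {..<N}" using I(1) by auto
  then have fin: "finite I" "finite J" by (auto simp: J_def intro: finite_subset)
  have sum_split: "(\<Sum>k<N. F k) = (\<Sum>k\<in>I. F k) + (\<Sum>k\<in>J. F k)" for F :: "nat \<Rightarrow> real"
    using sum.subset_diff[OF \<open>I \<subseteq> {..<N}\<close>, of F] by (simp add: J_def)

  have regret: "(\<Sum>k<N. h k * p k (x k - u)) \<le> eps * (\<Sum>k<N. h k)" if u: "u \<in> X" for u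
  proof -
    have "(h k * norm (p k))\<^sup>2 = eps * h k" for k
      by (simp add: h_def step_size_def power2_eq_square)
    then have "(\<Sum>k<N. h k * p k (x k - u)) \<le> d u + eps * (\<Sum>k<N. h k) / 2"
      using mirror_descent_regret[OF fin_dim X_compact X(2) prox u, of x N h p] run performed
      by (simp add: amd_run_def h_def sum_distrib_left)
    \<comment> \<open>this is the stopping test, as \<open>eps * h k = eps\<^sup>2 / (norm (p k))\<^sup>2\<close>\<close>
    moreover have "2 * Theta0\<^sup>2 \<le> eps * (\<Sum>k<N. h k)"
    proof -
      have "2 * Theta0\<^sup>2 / eps\<^sup>2 \<le> (\<Sum>k<N. 1 / (norm (p k))\<^sup>2)"
        using N(1) by (simp add: stops_after_def stop_test_def)
      then have "2 * Theta0\<^sup>2 \<le> eps\<^sup>2 * (\<Sum>k<N. 1 / (norm (p k))\<^sup>2)"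
        using eps by (simp add: field_simps)
      then show ?thesis
        by (simp add: h_def step_size_def sum_distrib_left power2_eq_square)
    qed
    ultimately show ?thesis using Theta0(2)[OF u] by simp
  qed
  have prod_step: "h k * (f (x k) - f u) \<le> h k * p k (x k - u)" if "k \<in> I" "u \<in> X" for k u
  proof -
    have "f (x k) + p k (u - x k) \<le> f u"
      using run_prod[OF performed] I[OF that(1)] that(2) by (simp add: subdifferential_def)
    then show ?thesis
      using h_pos[OF I(1)[OF that(1)]] by (simp add: blinfun.diff_right)
  qed
  have nonprod_step: "h k * (eps - g (ix k) u) < h k * p k (x k - u)" if "k \<in> J" for k u
  proof -
    note np = run_nonprod[OF performed[OF J(1)[OF that]] J(2)[OF that]]
    have "g (ix k) (x k) + p k (u - x k) \<le> g (ix k) u"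
      using np(3) by (simp add: subdifferential_def)
    then show ?thesis
      using h_pos[OF J(1)[OF that]] np(2) J(2)[OF that] by (simp add: blinfun.diff_right)
  qed

  \<comment> \<open>if all steps were non-productive, the Slater point would violate the regret bound\<close>
  have "I \<noteq> {}"
  proof
    assume "I = {}"
    then have "J = {..<N}" by (simp add: J_def)
    have "eps * (\<Sum>k<N. h k) < (\<Sum>k<N. h k * p k (x k - xb))"
      unfolding sum_distrib_left
    proof (rule sum_strict_mono)
      fix k assume "k \<in> {..<N}"
      then have k: "k \<in> J" using \<open>J = {..<N}\<close> by simp
      have "g (ix k) xb < 0"
        using run_nonprod(1)[OF performed] J[OF k] slater by blast
      then have "eps * h k < h k * (eps - g (ix k) xb)"
        using h_pos[OF J(1)[OF k]] by (simp add: algebra_simps mult_pos_neg)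
      then show "eps * h k < h k * p k (x k - xb)"
        using nonprod_step[OF k, of xb] by simp
    qed (use \<open>N > 0\<close> in auto)
    with regret[OF xb(1)] show False by simp
  qed
  define H where "H = (\<Sum>k\<in>I. h k)"
  have "H > 0" unfolding H_def using fin \<open>I \<noteq> {}\<close> h_pos I(1) by (intro sum_pos) auto
  define xo where "xo = primal_output m g eps x p N"
  define lo where "lo = dual_output m g eps x p ix N"
  have xo: "xo = (1 / H) *\<^sub>R (\<Sum>k\<in>I. h k *\<^sub>R x k)"
    by (simp add: xo_def primal_output_def H_def h_def I_def)
  have lo: "lo i = 1 / H * (\<Sum>j\<in>{j\<in>J. ix j = i}. h j)" for i
    by (simp add: lo_def dual_output_def H_def h_def I_def J_def)
  have I_X: "x k \<in> X" if "k \<in> I" for k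
    using run_prod[OF performed] I[OF that] by (simp add: subdifferential_def)
  note average = weighted_average[where h = h and x = x, OF fin(1) less_imp_le[OF h_pos[OF I(1)]]
      \<open>H > 0\<close>[unfolded H_def], folded H_def, folded xo]

  have "xo \<in> X" by (rule average(1)[OF _ X(2) I_X])
  moreover have "\<forall>i\<in>{1..m}. lo i \<ge> 0"
  proof
    fix i
    have "0 \<le> (\<Sum>j\<in>{j\<in>J. ix j = i}. h j)"
      using h_pos J(1) by (intro sum_nonneg) (auto intro: less_imp_le)
    then show "lo i \<ge> 0" using \<open>H > 0\<close> by (simp add: lo)
  qed
  moreover have "f xo - dual_objective X f m g lo \<le> eps"
  proof -
    have "f xo - eps \<le> f u + (\<Sum>i=1..m. lo i * g i u)" if u: "u \<in> X" for u
    proof -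
      have "(\<Sum>k\<in>I. h k * (f (x k) - f u)) + (\<Sum>k\<in>J. h k * (eps - g (ix k) u))
          \<le> (\<Sum>k<N. h k * p k (x k - u))"
        unfolding sum_split using prod_step u nonprod_step
        by (intro add_mono sum_mono) (auto intro: less_imp_le)
      also have "\<dots> \<le> eps * ((\<Sum>k\<in>I. h k) + (\<Sum>k\<in>J. h k))"
        using regret[OF u] by (simp only: sum_split)
      \<comment> \<open>the terms \<open>eps * h k\<close> with \<open>k \<in> J\<close> cancel\<close>
      finally have *: "(\<Sum>k\<in>I. h k * f (x k)) - H * f u - (\<Sum>k\<in>J. h k * g (ix k) u) \<le> eps * H"
        by (simp add: H_def algebra_simps sum.distrib sum_subtractf sum_distrib_left sum_distrib_right)
      have "(\<Sum>i=1..m. lo i * g i u)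
          = 1 / H * (\<Sum>i=1..m. \<Sum>j\<in>{j\<in>J. ix j = i}. h j * g (ix j) u)"
        by (simp add: lo sum_distrib_left sum_distrib_right)
      \<comment> \<open>the multipliers collect the non-productive steps by their active index\<close>
      also have "(\<Sum>i=1..m. \<Sum>j\<in>{j\<in>J. ix j = i}. h j * g (ix j) u) = (\<Sum>j\<in>J. h j * g (ix j) u)"
        using run_nonprod(1)[OF performed] J by (intro sum.group fin) auto
      finally have dual: "H * (\<Sum>i=1..m. lo i * g i u) = (\<Sum>j\<in>J. h j * g (ix j) u)"
        using \<open>H > 0\<close> by simp
      have "H * f xo \<le> (\<Sum>k\<in>I. h k * f (x k))"
        using average(2)[OF _ f_convex I_X] \<open>H > 0\<close> by (simp add: field_simps)
      with * dual have "H * (f xo - eps) \<le> H * (f u + (\<Sum>i=1..m. lo i * g i u))"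
        by (simp add: algebra_simps)
      then show ?thesis using \<open>H > 0\<close> by simp
    qed
    then have "f xo - eps \<le> dual_objective X f m g lo"
      unfolding dual_objective_def using xb(1) by (intro cINF_greatest) auto
    then show ?thesis by simp
  qed
  moreover have "?G xo \<le> eps"
    unfolding max_constraint_le_iff[OF m]
  proof
    fix i assume i: "i \<in> {1..m}"
    have "g i xo \<le> 1 / H * (\<Sum>k\<in>I. h k * g i (x k))"
      by (rule average(2)[OF _ g_convex[OF i]]) auto
    also have "\<dots> \<le> 1 / H * (\<Sum>k\<in>I. h k * eps)"
    proof (intro mult_left_mono sum_mono)
      fix k assume k: "k \<in> I"
      show "g i (x k) \<le> eps" using max_constraint_ge[OF i, of g "x k"] I(2)[OF k] by simp
      show "0 \<le> h k" using h_pos[OF I(1)[OF k]] by simp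
    qed (use \<open>H > 0\<close> in simp)
    also have "\<dots> = eps"
      using \<open>H > 0\<close> by (simp add: H_def flip: sum_distrib_right)
    finally show "g i xo \<le> eps" .
  qed
  ultimately show ?thesis
    using N unfolding xo_def lo_def R_def by blast
qed

end
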